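(* Let $G$ be an abelian group (written additively) and let $A=\{a_1,\ldots,a_n\}$ and $B=\{b_1,\ldots,b_n\}$ be two finite subsets of $G$ of the same cardinality $n$. If there is an acyclic matching from $A$ to $B$, then the matching matrix $M_{A,B}$ is invertible (that is, its determinant is a nonzero element of the polynomial ring $D(G)$).
   Context: A matching from $A$ to $B$ is a bijection $\varphi:A\to B$ such that $a+\varphi(a)\notin A$ for every $a\in A$. For a matching $\varphi:A\to B$, its multiplicity function $m_\varphi:G\to\mathbb{Z}_{\ge 0}$ is $m_\varphi(x)=\#\{a\in A:\ a+\varphi(a)=x\}$. A matching $\varphi:A\to B$ is called acyclic if for every matching $\psi:A\to B$, $m_\varphi=m_\psi$ implies $\varphi=\psi$. For each $g\in G$ let $x_g$ be a variable (indeterminate), and let $D(G)$ be the commutative polynomial ring with integer coefficients in all the variables $x_g$, $g\in G$. The matching matrix from $A$ to $B$ is the $n\times n$ matrix $M_{A,B}=[m_{ij}]$ over the integral domain $D(G)$ with $m_{ij}=x_{a_i+b_j}$ if $a_i+b_j\notin A$, and $m_{ij}=0$ otherwise. Invertibility of $M_{A,B}$ is understood as having nonzero determinant, i.e. invertibility over the field of fractions of $D(G)$. *)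

theory Defs
  imports "HOL-Library.Poly_Mapping" "Jordan_Normal_Form.Determinant"
begin

text \<open>A map from \<open>A\<close> to \<open>B\<close> is represented by a total function of which only the values on
  \<open>A\<close> matter; accordingly, maps are compared only on \<open>A\<close>.\<close>

definition is_matching :: "'g::ab_group_add set \<Rightarrow> 'g set \<Rightarrow> ('g \<Rightarrow> 'g) \<Rightarrow> bool" where
  "is_matching A B \<phi> \<longleftrightarrow> bij_betw \<phi> A B \<and> (\<forall>a\<in>A. a + \<phi> a \<notin> A)"

definition multiplicity_fun :: "'g::ab_group_add set \<Rightarrow> ('g \<Rightarrow> 'g) \<Rightarrow> 'g \<Rightarrow> nat" where
  "multiplicity_fun A \<phi> x = card {a \<in> A. a + \<phi> a = x}"

definition acyclic_matching :: "'g::ab_group_add set \<Rightarrow> 'g set \<Rightarrow> ('g \<Rightarrow> 'g) \<Rightarrow> bool" where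
  "acyclic_matching A B \<phi> \<longleftrightarrow> is_matching A B \<phi> \<and>
     (\<forall>\<psi>. is_matching A B \<psi> \<longrightarrow> multiplicity_fun A \<phi> = multiplicity_fun A \<psi>
        \<longrightarrow> (\<forall>a\<in>A. \<phi> a = \<psi> a))"

text \<open>The polynomial ring \<open>D(G)\<close> over the integers with one variable for each element of \<open>G\<close>:
  a monomial is a finitely supported exponent function on \<open>G\<close>, and a polynomial is a finitely
  supported integer coefficient function on monomials, multiplied by convolution.\<close>

type_synonym 'g mpoly_ring = "('g \<Rightarrow>\<^sub>0 nat) \<Rightarrow>\<^sub>0 int"

definition var :: "'g \<Rightarrow> 'g mpoly_ring" where
  "var g = Poly_Mapping.single (Poly_Mapping.single g 1) 1"

text \<open>The sets are given by enumerations \<open>A = {a 0, \<dots>, a (n - 1)}\<close> and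
  \<open>B = {b 0, \<dots>, b (n - 1)}\<close>, since matrices are indexed from \<open>0\<close>.\<close>

definition matching_matrix ::
  "nat \<Rightarrow> (nat \<Rightarrow> 'g::ab_group_add) \<Rightarrow> (nat \<Rightarrow> 'g) \<Rightarrow> 'g mpoly_ring mat" where
  "matching_matrix n a b =
     mat n n (\<lambda>(i, j). if a i + b j \<notin> a ` {..<n} then var (a i + b j) else 0)"

end

theory Submission
  imports Defs
begin

text \<open>Each permutation contributes to the Leibniz expansion of \<open>det M\<^bsub>A,B\<^esub>\<close> either zero or, up to
  sign, the monomial whose exponent function is the multiplicity function of the corresponding
  matching. Acyclicity says that no other matching yields the monomial of \<open>\<phi>\<close>, so nothing can
  cancel it and its coefficient is \<open>\<plusminus>1\<close>.\<close>

lemma prod_var: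
  "(\<Prod>i\<in>I. var (f i)) = Poly_Mapping.single (\<Sum>i\<in>I. Poly_Mapping.single (f i) 1) 1"
  by (induction I rule: infinite_finite_induct) (simp_all add: var_def mult_single)

text \<open>Each summand adds 1 to the exponent of one variable, so the exponent of \<open>x\<close>
  counts how often \<open>f\<close> hits \<open>x\<close>. This is what lets a multiplicity function
  be read as a monomial.\<close>

lemma lookup_sum_single:
  assumes "finite I"
  shows "Poly_Mapping.lookup (\<Sum>i\<in>I. Poly_Mapping.single (f i) (1::nat)) x = card {i \<in> I. f i = x}"
proof -
  have "Poly_Mapping.lookup (\<Sum>i\<in>I. Poly_Mapping.single (f i) (1::nat)) x
      = (\<Sum>i\<in>I. if f i = x then 1 else 0)"
    by (simp add: lookup_sum lookup_single when_def del: One_nat_def)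
  also have "\<dots> = card {i \<in> I. f i = x}"
    using assms by (simp add: sum.If_cases Int_def)
  finally show ?thesis .
qed

text \<open>Multiplicities count elements of \<open>A\<close>, exponents count matrix indices; the
  enumeration is injective and carries one count to the other.\<close>

lemma multiplicity_fun_reindex:
  assumes "bij_betw a I A"
  shows "multiplicity_fun A \<psi> x = card {i \<in> I. a i + \<psi> (a i) = x}"
proof -
  have "{y \<in> A. y + \<psi> y = x} = a ` {i \<in> I. a i + \<psi> (a i) = x}"
    using assms by (auto simp: bij_betw_def)
  moreover have "inj_on a {i \<in> I. a i + \<psi> (a i) = x}"
    using assms by (auto simp: bij_betw_def inj_on_def)
  ultimately show ?thesis
    by (simp add: multiplicity_fun_def card_image)
qed

lemma lookup_signof_mult:
  "Poly_Mapping.lookup (signof p * q :: 'g mpoly_ring) k = sign p * Poly_Mapping.lookup q k"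
  by (cases p rule: sign_cases) simp_all

text \<open>In the Leibniz expansion every summand other than that of \<open>p0\<close> has
  coefficient 0 at \<open>k\<close>, and the sign of \<open>p0\<close>, being 1 or -1, cannot
  annihilate the one that remains.\<close>

lemma det_nonzero_if_unique_term:
  fixes M :: "'g mpoly_ring mat"
  assumes M: "M \<in> carrier_mat n n" and p0: "p0 permutes {0..<n}"
    and term_p0: "Poly_Mapping.lookup (\<Prod>i = 0..<n. M $$ (i, p0 i)) k \<noteq> 0"
    and uniq: "\<And>p. p permutes {0..<n} \<Longrightarrow>
      Poly_Mapping.lookup (\<Prod>i = 0..<n. M $$ (i, p i)) k \<noteq> 0 \<Longrightarrow> p = p0"
  shows "det M \<noteq> 0"
proof -
  let ?t = "\<lambda>p. Poly_Mapping.lookup (signof p * (\<Prod>i = 0..<n. M $$ (i, p i))) k"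
  have "Poly_Mapping.lookup (det M) k = (\<Sum>p | p permutes {0..<n}. ?t p)"
    using M by (simp add: det_def'[OF M] lookup_sum)
  also have "\<dots> = (\<Sum>p\<in>{p0}. ?t p)"
    using p0 uniq by (intro sum.mono_neutral_right)
      (auto simp: finite_permutations lookup_signof_mult)
  finally have "Poly_Mapping.lookup (det M) k \<noteq> 0"
    using term_p0 by (simp add: lookup_signof_mult sign_def)
  then show ?thesis by auto
qed

theorem proposition1:
  fixes A B :: "'g::ab_group_add set"
    and n :: nat
    and a b :: "nat \<Rightarrow> 'g"
  assumes "bij_betw a {..<n} A"
    and "bij_betw b {..<n} B"
    and "\<exists>\<phi>. acyclic_matching A B \<phi>"
  shows "det (matching_matrix n a b) \<noteq> 0"
proof -
  note a = assms(1) and b = assms(2)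
  obtain \<phi> where \<phi>: "is_matching A B \<phi>"
    and acyc: "\<And>\<psi> x. is_matching A B \<psi> \<Longrightarrow> multiplicity_fun A \<phi> = multiplicity_fun A \<psi>
      \<Longrightarrow> x \<in> A \<Longrightarrow> \<phi> x = \<psi> x"
    using assms(3) unfolding acyclic_matching_def by blast
  let ?M = "matching_matrix n a b"
  define ai bi where "ai = inv_into {..<n} a" and "bi = inv_into {..<n} b"
  \<comment> \<open>The exponent function of the product of the variables at
    \<open>a i + f i\<close>. Taking \<open>f\<close> on indices allows both
    \<open>b \<circ> p\<close> for a permutation and \<open>\<psi> \<circ> a\<close> for a
    matching.\<close>
  define mon :: "(nat \<Rightarrow> 'g) \<Rightarrow> 'g \<Rightarrow>\<^sub>0 nat"
    where "mon f = (\<Sum>i = 0..<n. Poly_Mapping.single (a i + f i) 1)" for f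
  have aA: "a ` {..<n} = A" using a by (simp add: bij_betw_def)
  have ai: "ai (a i) = i" if "i < n" for i
    using a that by (simp add: ai_def bij_betw_def)
  have bi: "b (bi y) = y" if "y \<in> B" for y
    using b that by (auto simp: bi_def bij_betw_def f_inv_into_f)
  have ai_bij: "bij_betw ai A {..<n}" and bi_bij: "bij_betw bi B {..<n}"
    using a b by (simp_all add: ai_def bi_def bij_betw_inv_into)
  have mon_eq: "multiplicity_fun A \<psi> x = Poly_Mapping.lookup (mon (\<psi> \<circ> a)) x" for \<psi> x
    by (simp add: multiplicity_fun_reindex[OF a] mon_def lookup_sum_single atLeast0LessThan
        del: One_nat_def)
  have mon_cong: "mon f = mon g" if "\<And>i. i < n \<Longrightarrow> f i = g i" for f g
    using that by (simp add: mon_def)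
  have prod_M: "(\<Prod>i = 0..<n. ?M $$ (i, p i)) = Poly_Mapping.single (mon (b \<circ> p)) 1"
    if p: "p permutes {0..<n}" and "\<And>i. i < n \<Longrightarrow> a i + b (p i) \<notin> A" for p
  proof -
    have "(\<Prod>i = 0..<n. ?M $$ (i, p i)) = (\<Prod>i = 0..<n. var (a i + b (p i)))"
      using that permutes_in_image[OF p] by (intro prod.cong) (auto simp: matching_matrix_def aA)
    then show ?thesis by (simp add: prod_var mon_def)
  qed
  \<comment> \<open>The matching \<open>\<phi>\<close> transported to indices, so that
    \<open>b (p0 i) = \<phi> (a i)\<close>; from \<open>n\<close> on it is the identity, as
    \<open>permutes\<close> demands.\<close>
  define p0 where "p0 i = (if i < n then bi (\<phi> (a i)) else i)" for i
  have \<phi>_bij: "bij_betw \<phi> A B" and \<phi>_notin: "\<And>x. x \<in> A \<Longrightarrow> x + \<phi> x \<notin> A"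
    using \<phi> by (auto simp: is_matching_def)
  have a_in: "a i \<in> A" if "i < n" for i using aA that by auto
  have \<phi>_in: "\<phi> (a i) \<in> B" if "i < n" for i
    using \<phi>_bij a_in[OF that] by (auto simp: bij_betw_def)
  have p0: "p0 permutes {0..<n}"
  proof (rule bij_imp_permutes)
    have "bij_betw (bi \<circ> (\<phi> \<circ> a)) {..<n} {..<n}"
      using a \<phi>_bij bi_bij by (intro bij_betw_trans)
    then show "bij_betw p0 {0..<n} {0..<n}"
      unfolding atLeast0LessThan
      by (subst bij_betw_cong[where g = "bi \<circ> (\<phi> \<circ> a)"]) (simp_all add: p0_def)
  qed (simp add: p0_def)
  have b_p0: "b (p0 i) = \<phi> (a i)" if "i < n" for i
    using that bi \<phi>_in by (simp add: p0_def)
  have p0_eq: "mon (b \<circ> p0) = mon (\<phi> \<circ> a)"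
    by (rule mon_cong) (simp add: b_p0)
  show ?thesis
  proof (rule det_nonzero_if_unique_term)
    show "?M \<in> carrier_mat n n" by (simp add: matching_matrix_def)
    show "p0 permutes {0..<n}" by (rule p0)
    show "Poly_Mapping.lookup (\<Prod>i = 0..<n. ?M $$ (i, p0 i)) (mon (\<phi> \<circ> a)) \<noteq> 0"
      by (subst prod_M) (simp_all add: p0 b_p0 \<phi>_notin a_in p0_eq)
  next
    fix p
    assume p: "p permutes {0..<n}"
      and nz: "Poly_Mapping.lookup (\<Prod>i = 0..<n. ?M $$ (i, p i)) (mon (\<phi> \<circ> a)) \<noteq> 0"
    have p_less: "p i < n" if "i < n" for i
      using permutes_in_image[OF p] that by simp
    \<comment> \<open>A forbidden sum would put a zero entry into the product, which would then have
      no nonzero coefficient.\<close>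
    have notin: "a i + b (p i) \<notin> A" if "i < n" for i
    proof
      assume "a i + b (p i) \<in> A"
      then have "?M $$ (i, p i) = 0"
        using that p_less by (simp add: matching_matrix_def aA)
      then have "(\<Prod>i = 0..<n. ?M $$ (i, p i)) = 0"
        using that by (intro prod_zero) auto
      with nz show False by simp
    qed
    \<comment> \<open>The product is a single monomial, so its coefficient is nonzero only at its
      own exponent function.\<close>
    have mon_p: "mon (b \<circ> p) = mon (\<phi> \<circ> a)"
      using nz by (simp add: prod_M p notin lookup_single when_def split: if_splits)
    \<comment> \<open>The permutation carried back to a map from \<open>A\<close> to
      \<open>B\<close>, pairing \<open>a i\<close> with \<open>b (p i)\<close>. It is to be shown a
      matching with the multiplicities of \<open>\<phi>\<close>.\<close>
    define \<psi> where "\<psi> = b \<circ> (p \<circ> ai)"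
    have \<psi>a: "\<psi> (a i) = b (p i)" if "i < n" for i
      using that ai by (simp add: \<psi>_def)
    have "bij_betw \<psi> A B"
      unfolding \<psi>_def using ai_bij permutes_imp_bij[OF p] b
      by (auto intro!: bij_betw_trans simp: atLeast0LessThan)
    moreover have "\<forall>x\<in>a ` {..<n}. x + \<psi> x \<notin> A"
      using notin \<psi>a by simp
    ultimately have "is_matching A B \<psi>" by (simp add: is_matching_def aA)
    moreover have "mon (\<psi> \<circ> a) = mon (\<phi> \<circ> a)"
      unfolding mon_p[symmetric] by (rule mon_cong) (simp add: \<psi>a)
    then have "multiplicity_fun A \<phi> = multiplicity_fun A \<psi>"
      by (simp add: fun_eq_iff mon_eq)
    \<comment> \<open>Acyclicity makes \<open>\<psi>\<close> and \<open>\<phi>\<close> agree on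
      \<open>A\<close>; injectivity of \<open>b\<close> then turns this into equality of the
      indices.\<close>
    ultimately have "b (p i) = b (p0 i)" if "i < n" for i
      using acyc a_in[OF that] that by (simp add: b_p0 flip: \<psi>a)
    moreover have "inj_on b {..<n}" using b by (simp add: bij_betw_def)
    moreover have "p0 i < n" if "i < n" for i
      using permutes_in_image[OF p0] that by simp
    ultimately have "p i = p0 i" if "i < n" for i
      using that p_less by (auto dest: inj_onD)
    \<comment> \<open>Equality of permutations is equality of total functions; from \<open>n\<close>
      on both fix every index.\<close>
    moreover have "p i = p0 i" if "\<not> i < n" for i
      using that p by (auto simp: p0_def permutes_def)
    ultimately show "p = p0" by blast
  qed
qed

end
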